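(* Let $\lambda$ be a nonzero real number. For all integers $n\ge k\ge 0$, $$H_{\lambda}(n,k)=\sum_{l=k}^{n}{l \brace k}{n \brack l}\lambda^{n-l}.$$
   Context: For $\lambda\in\mathbb{R}$, $\lambda\neq 0$: $\langle x\rangle_{0,\lambda}=1$, $\langle x\rangle_{n,\lambda}=x(x+\lambda)\cdots(x+(n-1)\lambda)$ for $n\ge 1$. The falling factorial is $(x)_0=1$, $(x)_n=x(x-1)\cdots(x-n+1)$ for $n\ge 1$. The heterogeneous Stirling numbers of the second kind $H_\lambda(n,k)$ are defined by the polynomial identity $\langle x\rangle_{n,\lambda}=\sum_{k=0}^{n}H_{\lambda}(n,k)(x)_{k}$ for $n\ge 0$, with $H_\lambda(n,k)=0$ for $k<0$ or $n<k$. Here ${n\brace k}$ are the classical Stirling numbers of the second kind, $x^{n}=\sum_{k=0}^{n}{n \brace k}(x)_{k}$, and ${n\brack k}=(-1)^{n-k}S_1(n,k)$ are the classical unsigned Stirling numbers of the first kind, where $(x)_n=\sum_{k=0}^n S_1(n,k)x^k$. *)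

theory Defs
  imports Complex_Main "HOL-Combinatorics.Stirling"
begin

definition falling_fact :: "real \<Rightarrow> nat \<Rightarrow> real" where
  "falling_fact x n = (\<Prod>i<n. x - real i)"

definition gen_rising_fact :: "real \<Rightarrow> real \<Rightarrow> nat \<Rightarrow> real" where
  "gen_rising_fact lam x n = (\<Prod>i<n. x + real i * lam)"

text \<open>
  The heterogeneous Stirling numbers of the second kind. The polynomial identity is stated
  pointwise on the reals, and the coefficients outside the range \<open>k \<le> n\<close> are set to zero.
  Indices are natural numbers, so the convention for negative \<open>k\<close> has no counterpart.
  The lemma \<open>het_Stirling_ex1\<close> below shows that the description is proper.
\<close>

definition het_Stirling :: "real \<Rightarrow> nat \<Rightarrow> nat \<Rightarrow> real" where
  "het_Stirling lam n = (THE h. (\<forall>k>n. h k = 0) \<and>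
     (\<forall>x. gen_rising_fact lam x n = (\<Sum>k\<le>n. h k * falling_fact x k)))"

lemma falling_fact_Suc: "falling_fact x (Suc n) = falling_fact x n * (x - real n)"
  by (simp add: falling_fact_def)

lemma gen_rising_fact_Suc:
  "gen_rising_fact lam x (Suc n) = gen_rising_fact lam x n * (x + real n * lam)"
  by (simp add: gen_rising_fact_def)

lemma falling_fact_eq_0: "m < k \<Longrightarrow> falling_fact (real m) k = 0"
  by (auto simp: falling_fact_def)

lemma falling_fact_same_neq_0: "falling_fact (real m) m \<noteq> 0"
  by (auto simp: falling_fact_def)

lemma falling_fact_coeffs_unique:
  assumes eq: "\<And>x. (\<Sum>k\<le>n. a k * falling_fact x k) = (\<Sum>k\<le>n. b k * falling_fact x k)"
    and "m \<le> n"
  shows "a m = b m"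
  using \<open>m \<le> n\<close>
proof (induction m rule: less_induct)
  case (less m)
  have split: "(\<Sum>k\<le>n. c k * falling_fact (real m) k) =
      (\<Sum>k<m. c k * falling_fact (real m) k) + c m * falling_fact (real m) m" for c :: "nat \<Rightarrow> real"
  proof -
    have "(\<Sum>k\<le>n. c k * falling_fact (real m) k) = (\<Sum>k\<le>m. c k * falling_fact (real m) k)"
      using less.prems by (intro sum.mono_neutral_right) (auto simp: falling_fact_eq_0)
    then show ?thesis
      by (simp add: lessThan_Suc_atMost[symmetric])
  qed
  have "(\<Sum>k<m. a k * falling_fact (real m) k) = (\<Sum>k<m. b k * falling_fact (real m) k)"
    using less by (intro sum.cong) auto
  with eq[of "real m"] show ?case
    using falling_fact_same_neq_0[of m] by (simp add: split)
qed

lemma het_Stirling_exists: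
  "\<exists>h. (\<forall>k>n. h k = 0) \<and>
     (\<forall>x. gen_rising_fact lam x n = (\<Sum>k\<le>n. h k * falling_fact x k))"
proof (induction n)
  case 0
  show ?case
    by (rule exI[of _ "\<lambda>k. if k = 0 then 1 else 0"])
      (simp add: gen_rising_fact_def falling_fact_def)
next
  case (Suc n)
  then obtain h where h0: "\<And>k. k > n \<Longrightarrow> h k = 0"
    and h: "\<And>x. gen_rising_fact lam x n = (\<Sum>k\<le>n. h k * falling_fact x k)"
    by blast
  define g where "g = (\<lambda>k. (if k = 0 then 0 else h (k - 1)) + (real k + real n * lam) * h k)"
  have "gen_rising_fact lam x (Suc n) = (\<Sum>k\<le>Suc n. g k * falling_fact x k)" for x
  proof -
    have "gen_rising_fact lam x (Suc n) =
        (\<Sum>k\<le>n. h k * falling_fact x (Suc k)) +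
        (\<Sum>k\<le>n. (real k + real n * lam) * h k * falling_fact x k)"
      unfolding gen_rising_fact_Suc h sum_distrib_right falling_fact_Suc sum.distrib[symmetric]
      by (intro sum.cong refl) (simp add: algebra_simps)
    also have "(\<Sum>k\<le>n. h k * falling_fact x (Suc k)) =
        (\<Sum>k\<le>Suc n. (if k = 0 then 0 else h (k - 1)) * falling_fact x k)"
      by (subst sum.atMost_Suc_shift) simp
    also have "(\<Sum>k\<le>n. (real k + real n * lam) * h k * falling_fact x k) =
        (\<Sum>k\<le>Suc n. (real k + real n * lam) * h k * falling_fact x k)"
      by (simp add: h0)
    finally show ?thesis
      by (simp only: g_def distrib_right sum.distrib)
  qed
  moreover have "\<forall>k>Suc n. g k = 0"
    by (auto simp: g_def h0)
  ultimately show ?case by blast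
qed

lemma het_Stirling_ex1:
  "\<exists>!h. (\<forall>k>n. h k = 0) \<and>
     (\<forall>x. gen_rising_fact lam x n = (\<Sum>k\<le>n. h k * falling_fact x k))"
proof (rule ex_ex1I[OF het_Stirling_exists])
  fix g h
  assume g: "(\<forall>k>n. g k = 0) \<and>
      (\<forall>x. gen_rising_fact lam x n = (\<Sum>k\<le>n. g k * falling_fact x k))"
    and h: "(\<forall>k>n. h k = 0) \<and>
      (\<forall>x. gen_rising_fact lam x n = (\<Sum>k\<le>n. h k * falling_fact x k))"
  show "g = h"
  proof
    fix k
    show "g k = h k"
    proof (cases "k \<le> n")
      case True
      have "(\<Sum>k\<le>n. g k * falling_fact x k) = (\<Sum>k\<le>n. h k * falling_fact x k)" for x
        using g h by metis
      then show ?thesis using True by (rule falling_fact_coeffs_unique)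
    next
      case False
      then have "k > n" by simp
      with g h show ?thesis by metis
    qed
  qed
qed

text \<open>
  The library defines \<^const>\<open>Stirling\<close> (second kind) and \<^const>\<open>stirling\<close> (unsigned, first kind)
  by recurrences. The next two lemmas are their usual definitions as connection coefficients;
  the signed number of the first kind is \<open>(-1) ^ (n - k) * stirling n k\<close>.
\<close>

lemma power_eq_sum_Stirling: "x ^ n = (\<Sum>k\<le>n. real (Stirling n k) * falling_fact x k)"
proof (induction n)
  case 0
  show ?case by (simp add: falling_fact_def)
next
  case (Suc n)
  have "x ^ Suc n = (\<Sum>k\<le>n. real (Stirling n k) * falling_fact x (Suc k)) +
      (\<Sum>k\<le>n. real k * real (Stirling n k) * falling_fact x k)"
    unfolding power_Suc Suc sum_distrib_left falling_fact_Suc sum.distrib[symmetric]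
    by (intro sum.cong refl) (simp add: algebra_simps)
  also have "(\<Sum>k\<le>n. real k * real (Stirling n k) * falling_fact x k) =
      (\<Sum>k\<le>Suc n. real k * real (Stirling n k) * falling_fact x k)"
    by simp
  also have "\<dots> = (\<Sum>k\<le>n. real (Suc k) * real (Stirling n (Suc k)) * falling_fact x (Suc k))"
    by (subst sum.atMost_Suc_shift) simp
  finally show ?case
    unfolding sum.atMost_Suc_shift
    by (simp add: sum.distrib distrib_right)
qed

lemma falling_fact_eq_sum_stirling:
  "falling_fact x n = (\<Sum>k\<le>n. (-1) ^ (n - k) * real (stirling n k) * x ^ k)"
proof -
  have "falling_fact x n = (-1) ^ n * pochhammer (- x) n"
    by (induction n) (auto simp: falling_fact_def pochhammer_Suc algebra_simps)
  also have "pochhammer (- x) n = (\<Sum>k\<le>n. real (stirling n k) * (- x) ^ k)"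
    by (simp add: stirling_pochhammer)
  also have "(-1) ^ n * \<dots> = (\<Sum>k\<le>n. (-1) ^ (n - k) * real (stirling n k) * x ^ k)"
    unfolding sum_distrib_left
  proof (rule sum.cong)
    fix k assume "k \<in> {..n}"
    then have "(-1 :: real) ^ n = (-1) ^ (n - k) * (-1) ^ k"
      by (simp add: power_add[symmetric])
    moreover have "(-1 :: real) ^ k * (- x) ^ k = x ^ k"
      by (simp flip: power_mult_distrib)
    ultimately show "(-1) ^ n * (real (stirling n k) * (- x) ^ k) =
        (-1) ^ (n - k) * real (stirling n k) * x ^ k"
      by (metis mult.assoc mult.left_commute)
  qed simp
  finally show ?thesis .
qed

end

theory Submission
  imports Defs
begin

text \<open>Rescaling \<open>x\<close> by \<open>lam\<close> turns the generalized rising factorial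
  into an ordinary one, whose monomial coefficients are the unsigned Stirling numbers of the first
  kind. Expanding each \<open>x ^ l\<close> in falling factorials by
  \<open>power_eq_sum_Stirling\<close> and collecting terms yields the claimed coefficients;
  uniqueness of falling factorial coefficients identifies them with
  \<open>het_Stirling\<close>.\<close>

lemma gen_rising_fact_eq_pochhammer:
  assumes "lam \<noteq> 0"
  shows "gen_rising_fact lam x n = lam ^ n * pochhammer (x / lam) n"
  using assms
  by (induction n) (simp_all add: gen_rising_fact_def pochhammer_Suc field_simps)

text \<open>In \<open>lam ^ n * (x / lam) ^ l\<close> the powers of \<open>lam\<close> combine to
  \<open>lam ^ (n - l)\<close>, as \<open>l \<le> n\<close>.\<close>

lemma gen_rising_fact_eq_sum_stirling:
  assumes "lam \<noteq> 0"
  shows "gen_rising_fact lam x n = (\<Sum>l\<le>n. real (stirling n l) * lam ^ (n - l) * x ^ l)"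
  unfolding gen_rising_fact_eq_pochhammer[OF assms] stirling_pochhammer[symmetric] sum_distrib_left
  using assms by (intro sum.cong) (simp_all add: power_diff power_divide)

text \<open>Unfolds the definite description once and for all: by \<open>het_Stirling_ex1\<close>
  any candidate with the two properties is the right one.\<close>

lemma het_Stirling_eqI:
  assumes "\<And>k. k > n \<Longrightarrow> h k = 0"
    and "\<And>x. gen_rising_fact lam x n = (\<Sum>k\<le>n. h k * falling_fact x k)"
  shows "het_Stirling lam n = h"
  unfolding het_Stirling_def using assms by (intro the1_equality[OF het_Stirling_ex1]) simp

theorem theorem2p10:
  fixes lam :: real and n k :: nat
  assumes "lam \<noteq> 0" and "k \<le> n"
  shows "het_Stirling lam n k =
    (\<Sum>l=k..n. real (Stirling l k) * real (stirling n l) * lam ^ (n - l))"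
proof -
  define h where
    "h = (\<lambda>k. \<Sum>l=k..n. real (Stirling l k) * real (stirling n l) * lam ^ (n - l))"
  have "gen_rising_fact lam x n = (\<Sum>k\<le>n. h k * falling_fact x k)" for x
  proof -
    have "gen_rising_fact lam x n =
        (\<Sum>l\<le>n. \<Sum>k\<le>l. real (Stirling l k) * real (stirling n l) * lam ^ (n - l) * falling_fact x k)"
      unfolding gen_rising_fact_eq_sum_stirling[OF assms(1)] power_eq_sum_Stirling[of x]
        sum_distrib_left
      by (simp add: mult_ac)
    \<comment> \<open>Both double sums run over the triangle \<open>k \<le> l \<le> n\<close>;
      swapping the pairs exchanges the order of summation.\<close>
    also have "\<dots> = (\<Sum>k\<le>n. \<Sum>l=k..n.
        real (Stirling l k) * real (stirling n l) * lam ^ (n - l) * falling_fact x k)"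
      unfolding sum.Sigma[OF finite_atMost ballI[OF finite_atMost]]
        sum.Sigma[OF finite_atMost ballI[OF finite_atLeastAtMost]]
      by (rule sum.reindex_bij_witness[of _ prod.swap prod.swap]) auto
    finally show ?thesis
      by (simp add: h_def sum_distrib_right)
  qed
  \<comment> \<open>For \<open>k > n\<close> the range \<open>{k..n}\<close> is empty, so
    \<open>h k = 0\<close> as required.\<close>
  then have "het_Stirling lam n = h"
    by (intro het_Stirling_eqI) (simp_all add: h_def)
  then show ?thesis
    by (simp add: h_def)
qed

end
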